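(* Consider a player $i$ in a finite extensive-form game with perfect recall. For any transformation $\phi_i=\sum_{j\in\mathcal J_i}\lambda_i[j]\,\phi_{j\to q_j}\in\mathrm{co}\,\widetilde\Psi_i$, with $\lambda_i\in\Delta(\mathcal J_i)$ and $q_j\in\mathcal Q_j$ for each $j\in\mathcal J_i$, the vector $q_i\in\mathbb R^{\Sigma_i}$ computed by the following algorithm satisfies $q_i\in\mathcal Q_i$ and $\phi_i(q_i)=q_i$; furthermore, the algorithm runs in time $O(|\Sigma_i|\mathfrak D_i)$. Algorithm: set $q_i[\varnothing]=1$. Go through the sequences $\sigma=(j,a)\in\Sigma_i^*$ in top-down order (so that $\sigma_j$ is processed before $(j,a)$). For each of them let $d_\sigma=\sum_{j'\preceq j}\lambda_i[j']$; if $d_\sigma=0$, set $q_i[\sigma]=q_i[\sigma_j]/|\mathcal A_j|$; otherwise set $$q_i[\sigma]=\frac1{d_\sigma}\sum_{j'\preceq j}\lambda_i[j']\,q_{j'}[\sigma]\,q_i[\sigma_{j'}].$$ After all sequences are processed, return $q_i$.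
   Context: $\mathcal J_i$ is the set of information sets of player $i$ and $\mathcal A_j$ the finite nonempty set of actions at $j\in\mathcal J_i$. For $j,j'\in\mathcal J_i$, $j\prec j'$ if some path from the root of the game tree to a node of $j'$ passes through a node of $j$ ($j\ne j'$), and $j\preceq j'$ if $j=j'$ or $j\prec j'$. Sequences: $\Sigma_i=\{(j,a):j\in\mathcal J_i,a\in\mathcal A_j\}\cup\{\varnothing\}$, $\Sigma_i^*=\Sigma_i\setminus\{\varnothing\}$. By perfect recall every $j\in\mathcal J_i$ has a well-defined parent sequence $\sigma_j\in\Sigma_i$: the last sequence of player $i$ before reaching $j$ ($\varnothing$ if none); the information sets $j'\prec j$ are exactly those on the chain of parent sequences of $j$. $\mathfrak D_i$ is the maximum depth of any $j\in\mathcal J_i$ (number of information sets $j'\preceq j$). For $\sigma=(j',a')$, $\sigma\succeq j$ means $j\preceq j'$; $\varnothing\not\succeq j$. $\mathcal Q_i=\{q\in\mathbb R^{\Sigma_i}_{\ge0}: q[\varnothing]=1,\ q[\sigma_j]=\sum_{a\in\mathcal A_j}q[(j,a)]\ \forall j\in\mathcal J_i\}$. With $\Sigma_j=\{\sigma\in\Sigma_i:\sigma\succeq j\}$, $\mathcal Q_j$ is the set of $q\in\mathbb R_{\ge0}^{\Sigma_j}$ with $\sum_{a\in\mathcal A_j}q[(j,a)]=1$ and $q[\sigma_{j'}]=\sum_{a\in\mathcal A_{j'}}q[(j',a)]$ for all $j'\succ j$; $\Pi_j=\mathcal Q_j\cap\{0,1\}^{\Sigma_j}$. For $j\in\mathcal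 J_i$ and $q\in\mathcal Q_j$, $\phi_{j\to q}:\mathbb R^{\Sigma_i}\to\mathbb R^{\Sigma_i}$ is the linear map $\phi_{j\to q}(x)[\sigma]=x[\sigma]$ if $\sigma\not\succeq j$ and $\phi_{j\to q}(x)[\sigma]=q[\sigma]\,x[\sigma_j]$ if $\sigma\succeq j$. $\widetilde\Psi_i=\{\phi_{j\to\hat\pi}:j\in\mathcal J_i,\hat\pi\in\Pi_j\}$ is the set of coarse trigger deviation functions, and $\mathrm{co}$ denotes convex hull. Running time counts arithmetic operations. *)

theory Defs
  imports
    "HOL-Analysis.Analysis"
    "HOL-Library.Function_Algebras"
    "HOL-Library.Disjoint_Sets"
    "HOL-Library.Sublist"
    "HOL-Library.Monad_Syntax"
begin

section \<open>Functions as a real vector space\<close>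

text \<open>\<open>Function_Algebras\<close> provides the pointwise addition; the pointwise scaling makes
  \<^const>\<open>hull\<close> with \<^const>\<open>convex\<close> available for sets of maps between function spaces.\<close>

instantiation "fun" :: (type, real_vector) real_vector
begin

definition scaleR_fun_def: "scaleR r f = (\<lambda>x. r *\<^sub>R f x)"

instance
  by standard (simp_all add: scaleR_fun_def plus_fun_def fun_eq_iff scaleR_add_right scaleR_add_left)

end


section \<open>Finite extensive-form games with perfect recall\<close>

text \<open>The nodes of the game tree are the histories: the node \<open>h\<close> is the list of actions on the
  path from the root \<open>[]\<close> to it, so the nodes on that path are the prefixes of \<open>h\<close>.
  The owner \<open>None\<close> stands for chance.\<close>

record ('a, 'p) efg =
  players :: "'p set"
  hist :: "'a list set"
  owner :: "'a list \<Rightarrow> 'p option"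
  infosets :: "'p \<Rightarrow> 'a list set set"
  chance_prob :: "'a list \<Rightarrow> 'a \<Rightarrow> real"
  payoff :: "'p \<Rightarrow> 'a list \<Rightarrow> real"

type_synonym 'a infoset = "'a list set"

text \<open>\<open>None\<close> is the empty sequence.\<close>
type_synonym 'a seqn = "('a infoset \<times> 'a) option"

definition acts :: "('a, 'p) efg \<Rightarrow> 'a list \<Rightarrow> 'a set" where
  "acts G h = {a. h @ [a] \<in> hist G}"

definition extensive_form_game :: "('a, 'p) efg \<Rightarrow> bool" where
  "extensive_form_game G \<longleftrightarrow>
     finite (players G) \<and>
     finite (hist G) \<and> [] \<in> hist G \<and> (\<forall>h a. h @ [a] \<in> hist G \<longrightarrow> h \<in> hist G) \<and>
     (\<forall>h\<in>hist G. acts G h \<noteq> {} \<longrightarrow>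
        (case owner G h of
           None \<Rightarrow> (\<forall>a\<in>acts G h. 0 \<le> chance_prob G h a) \<and> (\<Sum>a\<in>acts G h. chance_prob G h a) = 1
         | Some p \<Rightarrow> p \<in> players G)) \<and>
     (\<forall>p\<in>players G.
        partition_on {h \<in> hist G. acts G h \<noteq> {} \<and> owner G h = Some p} (infosets G p) \<and>
        (\<forall>j\<in>infosets G p. \<forall>h\<in>j. \<forall>h'\<in>j. acts G h = acts G h'))"

definition actions_at :: "('a, 'p) efg \<Rightarrow> 'a infoset \<Rightarrow> 'a set" where
  "actions_at G j = (\<Union>h\<in>j. acts G h)"

definition infoset_of :: "('a, 'p) efg \<Rightarrow> 'p \<Rightarrow> 'a list \<Rightarrow> 'a infoset" where
  "infoset_of G i h = (THE j. j \<in> infosets G i \<and> h \<in> j)"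

text \<open>The information sets of player \<open>i\<close> visited strictly before \<open>h\<close>, each with the action
  taken there, in the order of play.\<close>
definition experience :: "('a, 'p) efg \<Rightarrow> 'p \<Rightarrow> 'a list \<Rightarrow> ('a infoset \<times> 'a) list" where
  "experience G i h =
     [(infoset_of G i (take k h), h ! k). k \<leftarrow> [0..<length h], owner G (take k h) = Some i]"

definition perfect_recall :: "('a, 'p) efg \<Rightarrow> bool" where
  "perfect_recall G \<longleftrightarrow>
     (\<forall>p\<in>players G. \<forall>j\<in>infosets G p. \<forall>h\<in>j. \<forall>h'\<in>j. experience G p h = experience G p h')"

text \<open>The choice of the node \<open>h\<close> of \<open>j\<close> is immaterial under perfect recall.\<close>
definition parent_seq :: "('a, 'p) efg \<Rightarrow> 'p \<Rightarrow> 'a infoset \<Rightarrow> 'a seqn" where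
  "parent_seq G i j =
     (let e = experience G i (SOME h. h \<in> j) in if e = [] then None else Some (last e))"

definition prec :: "('a, 'p) efg \<Rightarrow> 'p \<Rightarrow> 'a infoset \<Rightarrow> 'a infoset \<Rightarrow> bool" where
  "prec G i j j' \<longleftrightarrow>
     j \<in> infosets G i \<and> j' \<in> infosets G i \<and> j \<noteq> j' \<and> (\<exists>h'\<in>j'. \<exists>h\<in>j. prefix h h')"

definition preceq :: "('a, 'p) efg \<Rightarrow> 'p \<Rightarrow> 'a infoset \<Rightarrow> 'a infoset \<Rightarrow> bool" where
  "preceq G i j j' \<longleftrightarrow> (j \<in> infosets G i \<and> j = j') \<or> prec G i j j'"

definition max_depth :: "('a, 'p) efg \<Rightarrow> 'p \<Rightarrow> nat" where
  "max_depth G i = Max ((\<lambda>j. card {j'. preceq G i j' j}) ` infosets G i)"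

definition seqs_nonempty :: "('a, 'p) efg \<Rightarrow> 'p \<Rightarrow> ('a infoset \<times> 'a) set" where
  "seqs_nonempty G i = (SIGMA j:infosets G i. actions_at G j)"

definition seqs :: "('a, 'p) efg \<Rightarrow> 'p \<Rightarrow> 'a seqn set" where
  "seqs G i = insert None (Some ` seqs_nonempty G i)"

definition seq_succeq :: "('a, 'p) efg \<Rightarrow> 'p \<Rightarrow> 'a seqn \<Rightarrow> 'a infoset \<Rightarrow> bool" where
  "seq_succeq G i \<sigma> j \<longleftrightarrow> (case \<sigma> of None \<Rightarrow> False | Some (j', a') \<Rightarrow> preceq G i j j')"

definition seqs_below :: "('a, 'p) efg \<Rightarrow> 'p \<Rightarrow> 'a infoset \<Rightarrow> 'a seqn set" where
  "seqs_below G i j = {\<sigma> \<in> seqs G i. seq_succeq G i \<sigma> j}"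


section \<open>Sequence-form strategies and trigger deviations\<close>

text \<open>The vectors with nonnegative entries indexed by \<open>S\<close>, represented by total functions that
  vanish off \<open>S\<close>.\<close>
definition nonneg_vecs :: "'s set \<Rightarrow> ('s \<Rightarrow> real) set" where
  "nonneg_vecs S = {x. (\<forall>\<sigma>\<in>S. 0 \<le> x \<sigma>) \<and> (\<forall>\<sigma>. \<sigma> \<notin> S \<longrightarrow> x \<sigma> = 0)}"

definition strategies :: "('a, 'p) efg \<Rightarrow> 'p \<Rightarrow> ('a seqn \<Rightarrow> real) set" where
  "strategies G i =
     {q \<in> nonneg_vecs (seqs G i).
        q None = 1 \<and>
        (\<forall>j\<in>infosets G i. q (parent_seq G i j) = (\<Sum>a\<in>actions_at G j. q (Some (j, a))))}"

definition strategies_below :: "('a, 'p) efg \<Rightarrow> 'p \<Rightarrow> 'a infoset \<Rightarrow> ('a seqn \<Rightarrow> real) set" where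
  "strategies_below G i j =
     {q \<in> nonneg_vecs (seqs_below G i j).
        (\<Sum>a\<in>actions_at G j. q (Some (j, a))) = 1 \<and>
        (\<forall>j'. prec G i j j' \<longrightarrow>
           q (parent_seq G i j') = (\<Sum>a\<in>actions_at G j'. q (Some (j', a))))}"

definition pure_below :: "('a, 'p) efg \<Rightarrow> 'p \<Rightarrow> 'a infoset \<Rightarrow> ('a seqn \<Rightarrow> real) set" where
  "pure_below G i j = {q \<in> strategies_below G i j. \<forall>\<sigma>\<in>seqs_below G i j. q \<sigma> \<in> {0, 1}}"

definition trigger ::
  "('a, 'p) efg \<Rightarrow> 'p \<Rightarrow> 'a infoset \<Rightarrow> ('a seqn \<Rightarrow> real) \<Rightarrow> ('a seqn \<Rightarrow> real) \<Rightarrow> 'a seqn \<Rightarrow> real" where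
  "trigger G i j q x =
     (\<lambda>\<sigma>. if \<sigma> \<in> seqs_below G i j then q \<sigma> * x (parent_seq G i j) else x \<sigma>)"

definition coarse_triggers ::
  "('a, 'p) efg \<Rightarrow> 'p \<Rightarrow> (('a seqn \<Rightarrow> real) \<Rightarrow> 'a seqn \<Rightarrow> real) set" where
  "coarse_triggers G i = {trigger G i j p | j p. j \<in> infosets G i \<and> p \<in> pure_below G i j}"

definition distributions :: "'j set \<Rightarrow> ('j \<Rightarrow> real) set" where
  "distributions J = {l. (\<forall>j\<in>J. 0 \<le> l j) \<and> (\<Sum>j\<in>J. l j) = 1}"


section \<open>Counting arithmetic operations\<close>

text \<open>A computation is its result together with the number of arithmetic operations on reals
  (additions, multiplications, divisions and tests for zero) performed.\<close>

type_synonym 'r counted = "'r \<times> nat"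

definition ret :: "'r \<Rightarrow> 'r counted" where
  "ret x = (x, 0)"

definition bind_counted :: "'r counted \<Rightarrow> ('r \<Rightarrow> 's counted) \<Rightarrow> 's counted" where
  "bind_counted m f = (let (x, s) = m; (y, t) = f x in (y, s + t))"

adhoc_overloading Monad_Syntax.bind \<rightleftharpoons> bind_counted

definition add_op :: "real \<Rightarrow> real \<Rightarrow> real counted" where
  "add_op x y = (x + y, 1)"

definition mult_op :: "real \<Rightarrow> real \<Rightarrow> real counted" where
  "mult_op x y = (x * y, 1)"

definition div_op :: "real \<Rightarrow> real \<Rightarrow> real counted" where
  "div_op x y = (x / y, 1)"

definition is_zero_op :: "real \<Rightarrow> bool counted" where
  "is_zero_op x = (x = 0, 1)"

primrec sum_onto :: "('j \<Rightarrow> real counted) \<Rightarrow> 'j list \<Rightarrow> real \<Rightarrow> real counted" where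
  "sum_onto f [] s = ret s"
| "sum_onto f (j # js) s = do { v \<leftarrow> f j; s' \<leftarrow> add_op s v; sum_onto f js s' }"


section \<open>The fixed-point algorithm\<close>

text \<open>\<open>anc j\<close> lists, in any order, the information sets over which the sums at \<open>j\<close> range.\<close>

definition enumerates_ancestors ::
  "('a, 'p) efg \<Rightarrow> 'p \<Rightarrow> ('a infoset \<Rightarrow> 'a infoset list) \<Rightarrow> bool" where
  "enumerates_ancestors G i anc \<longleftrightarrow>
     (\<forall>j\<in>infosets G i. distinct (anc j) \<and> set (anc j) = {j'. preceq G i j' j})"

definition top_down_order :: "('a, 'p) efg \<Rightarrow> 'p \<Rightarrow> ('a infoset \<times> 'a) list \<Rightarrow> bool" where
  "top_down_order G i ss \<longleftrightarrow>
     distinct ss \<and> set ss = seqs_nonempty G i \<and>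
     (\<forall>k<length ss. parent_seq G i (fst (ss ! k)) \<in> insert None (Some ` set (take k ss)))"

definition seq_value ::
  "('a, 'p) efg \<Rightarrow> 'p \<Rightarrow> ('a infoset \<Rightarrow> 'a infoset list) \<Rightarrow> ('a infoset \<Rightarrow> real) \<Rightarrow>
   ('a infoset \<Rightarrow> 'a seqn \<Rightarrow> real) \<Rightarrow> ('a seqn \<Rightarrow> real) \<Rightarrow> 'a infoset \<times> 'a \<Rightarrow> real counted" where
  "seq_value G i anc l q x \<sigma> =
     do {
       d \<leftarrow> sum_onto (\<lambda>j'. ret (l j')) (anc (fst \<sigma>)) 0;
       z \<leftarrow> is_zero_op d;
       if z then div_op (x (parent_seq G i (fst \<sigma>))) (real (card (actions_at G (fst \<sigma>))))
       else do {
         s \<leftarrow> sum_onto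
                (\<lambda>j'. do { p \<leftarrow> mult_op (l j') (q j' (Some \<sigma>)); mult_op p (x (parent_seq G i j')) })
                (anc (fst \<sigma>)) 0;
         r \<leftarrow> div_op 1 d;
         mult_op r s
       }
     }"

primrec process ::
  "('a, 'p) efg \<Rightarrow> 'p \<Rightarrow> ('a infoset \<Rightarrow> 'a infoset list) \<Rightarrow> ('a infoset \<Rightarrow> real) \<Rightarrow>
   ('a infoset \<Rightarrow> 'a seqn \<Rightarrow> real) \<Rightarrow> ('a infoset \<times> 'a) list \<Rightarrow> ('a seqn \<Rightarrow> real) \<Rightarrow>
   ('a seqn \<Rightarrow> real) counted" where
  "process G i anc l q [] x = ret x"
| "process G i anc l q (\<sigma> # ss) x =
     do { v \<leftarrow> seq_value G i anc l q x \<sigma>; process G i anc l q ss (x(Some \<sigma> := v)) }"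

definition fixpoint_algorithm ::
  "('a, 'p) efg \<Rightarrow> 'p \<Rightarrow> ('a infoset \<Rightarrow> 'a infoset list) \<Rightarrow> ('a infoset \<times> 'a) list \<Rightarrow>
   ('a infoset \<Rightarrow> real) \<Rightarrow> ('a infoset \<Rightarrow> 'a seqn \<Rightarrow> real) \<Rightarrow> ('a seqn \<Rightarrow> real) counted" where
  "fixpoint_algorithm G i anc ss l q = process G i anc l q ss ((\<lambda>\<sigma>. 0)(None := 1))"

end

(* Writing d(j) for the weight lambda of the chain of information sets up to j, the entry computed
   at (j, a) says exactly that
     d(j) q[(j, a)] = sum over j' preceq j of lambda[j'] q_j'[(j, a)] q[sigma_j'],
   which also holds if d(j) = 0, because then all the weights on the chain vanish.  Since
   sigma = (j, a) succeeds j' iff j' preceq j, this is the fixed-point equation at (j, a):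
   the other triggers fix the entry and have total weight 1 - d(j).
   Summing over a and using the flow constraints of the q_j', the term j' = j contributes
   lambda[j] q[sigma_j], and the remaining terms are those of the equation at the parent sequence
   of j, hence sum to (d(j) - lambda[j]) q[sigma_j].  So the flow constraint of q at j follows
   after dividing by d(j); where d(j) = 0, the algorithm splits q[sigma_j] uniformly. *)
theory Submission
  imports Defs
begin

section \<open>Experiences\<close>

lemma experience_Nil [simp]: "experience G i [] = []"
  by (simp add: experience_def)

text \<open>Proper prefixes and entries of \<open>h\<close> do not change when an action is
  appended. This recursion lets the later inductions run along the path.\<close>

lemma experience_snoc:
  "experience G i (h @ [a]) =
     experience G i h @ (if owner G h = Some i then [(infoset_of G i h, a)] else [])"
proof -
  let ?f = "\<lambda>h k. if owner G (take k h) = Some i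
                   then [(infoset_of G i (take k h), h ! k)] else []"
  have "experience G i (h @ [a]) =
      concat (map (?f (h @ [a])) [0..<length h]) @ ?f (h @ [a]) (length h)"
    by (simp add: experience_def)
  also have "map (?f (h @ [a])) [0..<length h] = map (?f h) [0..<length h]"
    by (rule map_cong) (auto simp: nth_append)
  finally show ?thesis
    by (simp add: experience_def)
qed

lemma experience_append: "\<exists>us. experience G i (h @ w) = experience G i h @ us"
proof (induction w rule: rev_induct)
  case (snoc a w)
  then show ?case
    using experience_snoc[of G i "h @ w" a] by auto
qed simp

text \<open>Past a decision node of the player the experience grows strictly; this is what excludes
  a second visit to the same information set.\<close>

lemma experience_decision_append:
  assumes "owner G h = Some i"
  shows "\<exists>us. experience G i (h @ a # w) = experience G i h @ (infoset_of G i h, a) # us"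
  using experience_append[of G i "h @ [a]" w] assms by (simp add: experience_snoc)

lemma in_experienceE:
  assumes "(j, a) \<in> set (experience G i h)"
  obtains g w where "h = g @ a # w" "owner G g = Some i" "j = infoset_of G i g"
  using assms
proof (induction h arbitrary: thesis rule: rev_induct)
  case (snoc b h)
  consider "(j, a) \<in> set (experience G i h)"
    | "owner G h = Some i" "j = infoset_of G i h" "a = b"
    using snoc.prems(2) by (auto simp: experience_snoc split: if_splits)
  then show ?case
  proof cases
    case 1
    then obtain g w where "h = g @ a # w" "owner G g = Some i" "j = infoset_of G i g"
      using snoc.IH by metis
    then show ?thesis
      using snoc.prems(1)[of g "w @ [b]"] by simp
  next
    case 2
    then show ?thesis
      using snoc.prems(1)[of h "[]"] by simp
  qed
qed simp

text \<open>Take for \<open>g\<close> the last decision node of the player before \<open>h\<close>: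
  nodes of others in between record nothing.\<close>

lemma experience_lastE:
  assumes "experience G i h \<noteq> []"
  obtains g a w where "h = g @ a # w" "owner G g = Some i"
    "experience G i h = experience G i g @ [(infoset_of G i g, a)]"
  using assms
proof (induction h arbitrary: thesis rule: rev_induct)
  case (snoc b h)
  show ?case
  proof (cases "owner G h = Some i")
    case True
    then show ?thesis
      using snoc.prems(1)[of h b "[]"] by (simp add: experience_snoc)
  next
    case False
    then have eq: "experience G i (h @ [b]) = experience G i h"
      by (simp add: experience_snoc)
    then obtain g a w where "h = g @ a # w" "owner G g = Some i"
      "experience G i h = experience G i g @ [(infoset_of G i g, a)]"
      using snoc.IH snoc.prems(2) by metis
    then show ?thesis
      using snoc.prems(1)[of g a "w @ [b]"] eq by simp
  qed
qed simp


section \<open>The forest of information sets of a player\<close>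

locale perfect_recall_player =
  fixes G :: "('a, 'p) efg" and i :: 'p
  assumes game: "extensive_form_game G"
    and recall: "perfect_recall G"
    and player: "i \<in> players G"
begin

section \<open>Nodes, information sets and action sets of the player\<close>

lemma hist_prefix: "g @ w \<in> hist G \<Longrightarrow> g \<in> hist G"
proof (induction w rule: rev_induct)
  case (snoc a w)
  then show ?case
    using game unfolding extensive_form_game_def by (metis append_assoc)
qed simp

lemma infosets_partition:
  "partition_on {h \<in> hist G. acts G h \<noteq> {} \<and> owner G h = Some i} (infosets G i)"
  using game player by (simp add: extensive_form_game_def)

lemma infoset_node:
  assumes "j \<in> infosets G i" "h \<in> j"
  shows "h \<in> hist G" "acts G h \<noteq> {}" "owner G h = Some i"
  using partition_onD1[OF infosets_partition] assms by blast+

lemma infoset_of_eq: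
  assumes "j \<in> infosets G i" "h \<in> j"
  shows "infoset_of G i h = j"
  unfolding infoset_of_def
proof (rule the_equality)
  show "k = j" if "k \<in> infosets G i \<and> h \<in> k" for k
    using that assms disjointD[OF partition_onD2[OF infosets_partition]] by blast
qed (use assms in blast)

text \<open>The history continues after \<open>g\<close>, so \<open>g\<close> is not terminal and
  lies in a block of the partition.\<close>

lemma infoset_of_decision:
  assumes "g @ a # w \<in> hist G" "owner G g = Some i"
  shows "infoset_of G i g \<in> infosets G i" "g \<in> infoset_of G i g" "a \<in> acts G g"
proof -
  have ga: "g @ [a] \<in> hist G"
    using hist_prefix[of "g @ [a]" w] assms(1) by simp
  then show "a \<in> acts G g"
    by (simp add: acts_def)
  then have "g \<in> {h \<in> hist G. acts G h \<noteq> {} \<and> owner G h = Some i}"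
    using hist_prefix ga assms(2) by auto
  then obtain j where "j \<in> infosets G i" "g \<in> j"
    using partition_onD1[OF infosets_partition] by blast
  then show "infoset_of G i g \<in> infosets G i" "g \<in> infoset_of G i g"
    using infoset_of_eq by auto
qed

lemma infoset_nonempty: "j \<in> infosets G i \<Longrightarrow> \<exists>h. h \<in> j"
  using partition_onD3[OF infosets_partition] by (metis ex_in_conv)

lemma finite_infosets: "finite (infosets G i)"
proof (rule finite_elements[OF _ infosets_partition])
  show "finite {h \<in> hist G. acts G h \<noteq> {} \<and> owner G h = Some i}"
    using game by (simp add: extensive_form_game_def)
qed

lemma actions_at_eq:
  assumes "j \<in> infosets G i" "h \<in> j"
  shows "actions_at G j = acts G h"
proof -
  have "acts G g = acts G h" if "g \<in> j" for g
    using game player assms that unfolding extensive_form_game_def by blast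
  then show ?thesis
    unfolding actions_at_def using assms(2) by blast
qed

lemma finite_actions_at:
  assumes "j \<in> infosets G i"
  shows "finite (actions_at G j)"
proof -
  obtain h where h: "h \<in> j"
    using infoset_nonempty assms by blast
  \<comment> \<open>Actions at \<open>h\<close> correspond injectively to its children, which are
    among the finitely many histories.\<close>
  have "finite ((\<lambda>a. h @ [a]) -` hist G)"
    by (rule finite_vimageI) (use game in \<open>auto simp: extensive_form_game_def inj_def\<close>)
  then have "finite (acts G h)"
    by (simp add: acts_def vimage_def)
  then show ?thesis
    using actions_at_eq[OF assms h] by simp
qed

lemma actions_at_nonempty:
  assumes "j \<in> infosets G i"
  shows "actions_at G j \<noteq> {}"
  using infoset_nonempty[OF assms] actions_at_eq[OF assms] infoset_node(2)[OF assms] by blast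

lemma finite_seqs: "finite (seqs G i)"
  unfolding seqs_def seqs_nonempty_def
  using finite_infosets finite_actions_at by (intro finite.insertI finite_imageI finite_SigmaI)

lemma in_seqs_iff: "Some (j, a) \<in> seqs G i \<longleftrightarrow> j \<in> infosets G i \<and> a \<in> actions_at G j"
  by (auto simp: seqs_def seqs_nonempty_def)

section \<open>Experience of an information set: its chain of parent sequences\<close>

definition infoset_experience :: "'a infoset \<Rightarrow> ('a infoset \<times> 'a) list" where
  "infoset_experience j = experience G i (SOME h. h \<in> j)"

text \<open>Perfect recall makes the list independent of the node chosen, so facts about one path to
  \<open>j\<close> become facts about \<open>j\<close>.\<close>

lemma experience_eq:
  assumes "j \<in> infosets G i" "h \<in> j"
  shows "experience G i h = infoset_experience j"
proof -
  have "(SOME h. h \<in> j) \<in> j"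
    using assms(2) by (rule someI)
  then show ?thesis
    using recall player assms unfolding perfect_recall_def infoset_experience_def by blast
qed

lemma parent_seq_eq:
  "parent_seq G i j =
     (if infoset_experience j = [] then None else Some (last (infoset_experience j)))"
  by (simp add: parent_seq_def infoset_experience_def Let_def)

text \<open>A node of \<open>j'\<close> strictly above \<open>j\<close> leaves an entry in the
  experience, and every entry stems from such a node. By perfect recall any node of \<open>j\<close>
  reveals all predecessors.\<close>

lemma prec_iff:
  assumes j: "j \<in> infosets G i"
  shows "prec G i j' j \<longleftrightarrow> j' \<in> fst ` set (infoset_experience j)"
proof
  assume "prec G i j' j"
  then obtain g w where j': "j' \<in> infosets G i" "j' \<noteq> j" and g: "g \<in> j'" "g @ w \<in> j"
    by (auto simp: prec_def prefix_def)
  have "w \<noteq> []"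
    using infoset_of_eq[of j' g] infoset_of_eq[of j g] j j' g by auto
  then obtain a v where w: "w = a # v"
    by (cases w) auto
  obtain us where "experience G i (g @ w) = experience G i g @ (infoset_of G i g, a) # us"
    using experience_decision_append[OF infoset_node(3)[OF j'(1) g(1)]] w by blast
  then show "j' \<in> fst ` set (infoset_experience j)"
    using experience_eq[OF j g(2)] infoset_of_eq[OF j'(1) g(1)] by force
next
  assume "j' \<in> fst ` set (infoset_experience j)"
  moreover obtain h where h: "h \<in> j"
    using infoset_nonempty[OF j] by blast
  ultimately obtain a where "(j', a) \<in> set (experience G i h)"
    using experience_eq[OF j] by auto
  then obtain g w where gw: "h = g @ a # w" "owner G g = Some i" "j' = infoset_of G i g"
    by (rule in_experienceE)
  then have j': "j' \<in> infosets G i" "g \<in> j'"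
    using infoset_of_decision infoset_node(1)[OF j h] by auto
  \<comment> \<open>The experience grows strictly along a path, so \<open>j\<close> cannot be visited twice.\<close>
  have "experience G i g \<noteq> experience G i h"
    using experience_decision_append[OF gw(2), of a w] gw(1) by auto
  then have "j' \<noteq> j"
    using experience_eq[OF j] j'(2) h by metis
  then show "prec G i j' j"
    using j j' h gw(1) unfolding prec_def by (metis prefixI)
qed

text \<open>The last decision node before a node of \<open>j\<close> lies in \<open>k\<close>, so
  the experience up to it is that of \<open>k\<close>; only the step \<open>(k, a)\<close> is
  added.\<close>

lemma infoset_experience_parent:
  assumes j: "j \<in> infosets G i" and p: "parent_seq G i j = Some (k, a)"
  shows "k \<in> infosets G i" "a \<in> actions_at G k"
    and "infoset_experience j = infoset_experience k @ [(k, a)]"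
proof -
  obtain h where h: "h \<in> j"
    using infoset_nonempty[OF j] by blast
  have ne: "experience G i h \<noteq> []" and last: "last (experience G i h) = (k, a)"
    using p experience_eq[OF j h] by (auto simp: parent_seq_eq split: if_splits)
  obtain g b w where gw: "h = g @ b # w" "owner G g = Some i"
    "experience G i h = experience G i g @ [(infoset_of G i g, b)]"
    using ne by (rule experience_lastE)
  then have eq: "b = a" "infoset_of G i g = k"
    using last by auto
  then have k: "k \<in> infosets G i" "g \<in> k" "a \<in> acts G g"
    using infoset_of_decision[of g a w] gw(1,2) infoset_node(1)[OF j h] by auto
  then show "k \<in> infosets G i" "a \<in> actions_at G k"
    using actions_at_eq by auto
  show "infoset_experience j = infoset_experience k @ [(k, a)]"
    using gw(3) eq experience_eq[OF j h] experience_eq[OF k(1,2)] by simp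
qed

section \<open>Ancestor sets, over which the sums of the algorithm range\<close>

definition ancestors :: "'a infoset \<Rightarrow> 'a infoset set" where
  "ancestors j = {j'. preceq G i j' j}"

lemma ancestors_eq:
  assumes "j \<in> infosets G i"
  shows "ancestors j = insert j (fst ` set (infoset_experience j))"
  using assms prec_iff[OF assms] by (auto simp: ancestors_def preceq_def)

lemma ancestors_subset: "ancestors j \<subseteq> infosets G i"
  by (auto simp: ancestors_def preceq_def prec_def)

lemma finite_ancestors: "finite (ancestors j)"
  using ancestors_subset finite_infosets by (rule finite_subset)

lemma ancestors_root:
  assumes "j \<in> infosets G i" "parent_seq G i j = None"
  shows "ancestors j = {j}"
  using assms by (simp add: ancestors_eq parent_seq_eq split: if_splits)

text \<open>Passing from \<open>k\<close> to \<open>j\<close> adds exactly one ancestor, so sums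
  over ancestors of \<open>j\<close> split into the term of \<open>j\<close> and the sum for
  \<open>k\<close>.\<close>

lemma ancestors_parent:
  assumes "j \<in> infosets G i" "parent_seq G i j = Some (k, a)"
  shows "ancestors j = insert j (ancestors k)" "j \<notin> ancestors k"
proof -
  note k = infoset_experience_parent[OF assms]
  show "ancestors j = insert j (ancestors k)"
    using assms(1) k by (simp add: ancestors_eq)
  \<comment> \<open>The ancestors of \<open>k\<close> are the information sets in the experience of
    \<open>j\<close>, that is, the strict predecessors of \<open>j\<close>.\<close>
  have "\<not> prec G i j j"
    by (simp add: prec_def)
  then show "j \<notin> ancestors k"
    using prec_iff[OF assms(1)] k by (simp add: ancestors_eq)
qed

lemma in_seqs_below_iff:
  "Some (j, a) \<in> seqs_below G i j' \<longleftrightarrow> Some (j, a) \<in> seqs G i \<and> j' \<in> ancestors j"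
  by (simp add: seqs_below_def seq_succeq_def ancestors_def)

text \<open>Every information set is its own ancestor; hence an additive constant in the cost can be
  absorbed in a multiple of the depth.\<close>

lemma card_ancestors_pos: "j \<in> infosets G i \<Longrightarrow> 0 < card (ancestors j)"
  using finite_ancestors ancestors_eq by (auto simp: card_gt_0_iff)

lemma card_ancestors_le_max_depth: "j \<in> infosets G i \<Longrightarrow> card (ancestors j) \<le> max_depth G i"
  unfolding max_depth_def ancestors_def using finite_infosets by (intro Max_ge) auto


section \<open>Correctness of the recursion\<close>

text \<open>The recursion is taken as a system of equations for the final vector \<open>x\<close>,
  detached from the order of execution.\<close>

lemma flow_and_fixpoint:
  assumes l: "l \<in> distributions (infosets G i)"
    and q: "\<And>j. j \<in> infosets G i \<Longrightarrow> q j \<in> strategies_below G i j"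
    and d: "\<And>j. d j = (\<Sum>j'\<in>ancestors j. l j')"
    and step: "\<And>j a. Some (j, a) \<in> seqs G i \<Longrightarrow>
      x (Some (j, a)) =
        (if d j = 0 then x (parent_seq G i j) / real (card (actions_at G j))
         else 1 / d j * (\<Sum>j'\<in>ancestors j. l j' * q j' (Some (j, a)) * x (parent_seq G i j')))"
  shows "\<And>j. j \<in> infosets G i \<Longrightarrow>
           x (parent_seq G i j) = (\<Sum>a\<in>actions_at G j. x (Some (j, a)))"
    and "(\<Sum>j\<in>infosets G i. l j * trigger G i j (q j) x \<sigma>) = x \<sigma>"
proof -
  have l_zero: "l j' = 0" if "d j = 0" "j' \<in> ancestors j" for j j'
    using that l finite_ancestors ancestors_subset[of j]
    by (subst (asm) d, subst (asm) sum_nonneg_eq_0_iff) (auto simp: distributions_def)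
  have weighted: "d j * x (Some (j, a)) =
      (\<Sum>j'\<in>ancestors j. l j' * q j' (Some (j, a)) * x (parent_seq G i j'))"
    if "Some (j, a) \<in> seqs G i" for j a
    using step[OF that] l_zero[of j] by (cases "d j = 0") (auto simp: sum.neutral)
  show "x (parent_seq G i j) = (\<Sum>a\<in>actions_at G j. x (Some (j, a)))"
    if j: "j \<in> infosets G i" for j
  proof (cases "d j = 0")
    case True
    then have "x (Some (j, a)) = x (parent_seq G i j) / real (card (actions_at G j))"
      if "a \<in> actions_at G j" for a
      using step that j in_seqs_iff by simp
    \<comment> \<open>The shares add up to the whole because the action set is finite and
      nonempty.\<close>
    then show ?thesis
      using actions_at_nonempty[OF j] finite_actions_at[OF j] by simp
  next
    case False
    let ?c = "\<lambda>j'. l j' * (\<Sum>a\<in>actions_at G j. q j' (Some (j, a))) * x (parent_seq G i j')"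
    have flow_self: "(\<Sum>a\<in>actions_at G j. q j (Some (j, a))) = 1"
      using q[OF j] by (simp add: strategies_below_def)
    have "d j * (\<Sum>a\<in>actions_at G j. x (Some (j, a))) =
        (\<Sum>a\<in>actions_at G j. \<Sum>j'\<in>ancestors j. l j' * q j' (Some (j, a)) * x (parent_seq G i j'))"
      using weighted j by (simp add: sum_distrib_left in_seqs_iff)
    also have "\<dots> = (\<Sum>j'\<in>ancestors j. ?c j')"
      by (subst sum.swap) (simp add: sum_distrib_left sum_distrib_right)
    also have "\<dots> = d j * x (parent_seq G i j)"
    proof (cases "parent_seq G i j")
      case None
      then show ?thesis
        using flow_self d ancestors_root[OF j] by simp
    next
      case (Some ka)
      obtain k a where p: "parent_seq G i j = Some (k, a)"
        using Some by (cases ka) simp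
      note anc = ancestors_parent[OF j p]
      \<comment> \<open>Here \<open>j'\<close> strictly precedes \<open>j\<close>, so
        \<open>q j'\<close> has a flow constraint at \<open>j\<close>, whose parent sequence is
        \<open>(k, a)\<close>.\<close>
      have "(\<Sum>b\<in>actions_at G j. q j' (Some (j, b))) = q j' (Some (k, a))"
        if "j' \<in> ancestors k" for j'
      proof -
        have "j' \<in> ancestors j" "j' \<noteq> j"
          using that anc by auto
        then have "prec G i j' j"
          by (simp add: ancestors_def preceq_def)
        then show ?thesis
          using q[OF subsetD[OF ancestors_subset that]] p[symmetric] by (simp add: strategies_below_def)
      qed
      then have "(\<Sum>j'\<in>ancestors k. ?c j') = d k * x (Some (k, a))"
        using weighted[of k a] infoset_experience_parent[OF j p] by (simp add: in_seqs_iff)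
      \<comment> \<open>Adding the term \<open>l j * x (parent_seq G i j)\<close> of
        \<open>j\<close> itself gives the claim, since \<open>d j = l j + d k\<close>.\<close>
      then show ?thesis
        using anc flow_self p d[of j] d[of k] finite_ancestors by (simp add: algebra_simps)
    qed
    finally show ?thesis
      using False by simp
  qed
  have total: "(\<Sum>j\<in>infosets G i. l j) = 1"
    using l by (simp add: distributions_def)
  show "(\<Sum>j\<in>infosets G i. l j * trigger G i j (q j) x \<sigma>) = x \<sigma>"
  proof (cases "\<sigma> \<in> seqs G i \<and> \<sigma> \<noteq> None")
    case False
    \<comment> \<open>No trigger changes such an entry, and the weights sum to 1.\<close>
    then have "trigger G i j (q j) x \<sigma> = x \<sigma>" for j
      by (auto simp: trigger_def seqs_below_def seq_succeq_def split: option.splits)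
    then show ?thesis
      using total by (simp flip: sum_distrib_right)
  next
    case True
    then obtain j a where \<sigma>: "\<sigma> = Some (j, a)" "Some (j, a) \<in> seqs G i"
      by auto
    \<comment> \<open>Triggers at ancestors of \<open>j\<close> rewrite the entry; all others leave
      it fixed.\<close>
    have "(\<Sum>j'\<in>infosets G i. l j' * trigger G i j' (q j') x \<sigma>) =
        (\<Sum>j'\<in>infosets G i - ancestors j. l j' * trigger G i j' (q j') x \<sigma>) +
        (\<Sum>j'\<in>ancestors j. l j' * trigger G i j' (q j') x \<sigma>)"
      by (rule sum.subset_diff[OF ancestors_subset finite_infosets])
    also have "\<dots> = (\<Sum>j'\<in>infosets G i - ancestors j. l j') * x \<sigma> +
        (\<Sum>j'\<in>ancestors j. l j' * q j' \<sigma> * x (parent_seq G i j'))"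
      using \<sigma> by (simp add: trigger_def in_seqs_below_iff sum_distrib_right mult.assoc)
    also have "\<dots> = (1 - d j) * x \<sigma> + d j * x \<sigma>"
      using weighted[OF \<sigma>(2)] \<sigma>(1) total d[of j]
        sum.subset_diff[OF ancestors_subset finite_infosets, of l j] by simp
    finally show ?thesis
      by (simp add: algebra_simps)
  qed
qed

end


section \<open>Execution of the algorithm\<close>

lemma fst_bind_counted [simp]: "fst (bind_counted m f) = fst (f (fst m))"
  by (simp add: bind_counted_def Let_def split: prod.split)

lemma snd_bind_counted [simp]: "snd (bind_counted m f) = snd m + snd (f (fst m))"
  by (simp add: bind_counted_def Let_def split: prod.split)

lemmas op_defs = ret_def add_op_def mult_op_def div_op_def is_zero_op_def

section \<open>Values and costs of single steps and of whole runs\<close>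

lemma fst_sum_onto: "fst (sum_onto f js s) = s + (\<Sum>j\<leftarrow>js. fst (f j))"
  by (induction js arbitrary: s) (simp_all add: op_defs)

lemma snd_sum_onto: "snd (sum_onto f js s) = (\<Sum>j\<leftarrow>js. snd (f j) + 1)"
  by (induction js arbitrary: s) (simp_all add: op_defs)

lemma fst_seq_value:
  assumes "distinct (anc (fst \<sigma>))"
  shows "fst (seq_value G i anc l q x \<sigma>) =
    (let d = \<Sum>j'\<in>set (anc (fst \<sigma>)). l j'
     in if d = 0 then x (parent_seq G i (fst \<sigma>)) / real (card (actions_at G (fst \<sigma>)))
        else 1 / d * (\<Sum>j'\<in>set (anc (fst \<sigma>)). l j' * q j' (Some \<sigma>) * x (parent_seq G i j')))"
  using assms
  by (simp add: seq_value_def fst_sum_onto op_defs sum_list_distinct_conv_sum_set Let_def)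

text \<open>Each ancestor costs one addition for \<open>d\<close> and two multiplications and one
  addition for \<open>s\<close>. The zero test, the division and the last multiplication give 3; the
  uniform branch is cheaper.\<close>

lemma snd_seq_value_le: "snd (seq_value G i anc l q x \<sigma>) \<le> 4 * length (anc (fst \<sigma>)) + 3"
  by (simp add: seq_value_def snd_sum_onto op_defs sum_list_triv)

lemma process_unchanged:
  "\<tau> \<notin> Some ` set ss \<Longrightarrow> fst (process G i anc l q ss x) \<tau> = x \<tau>"
  by (induction ss arbitrary: x) (auto simp: op_defs)

text \<open>The witness \<open>z\<close> is the vector at the moment \<open>ss ! k\<close> is
  processed. Only entries from position \<open>k\<close> on are written afterwards, so elsewhere
  \<open>z\<close> is already final.\<close>

lemma process_value:
  assumes "distinct ss" "k < length ss"
  shows "\<exists>z. fst (process G i anc l q ss x) (Some (ss ! k)) =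
               fst (seq_value G i anc l q z (ss ! k)) \<and>
             (\<forall>\<tau>. \<tau> \<notin> Some ` set (drop k ss) \<longrightarrow> z \<tau> = fst (process G i anc l q ss x) \<tau>)"
  using assms
proof (induction ss arbitrary: x k)
  case (Cons \<sigma> ss)
  show ?case
  proof (cases k)
    case 0
    \<comment> \<open>By distinctness the rest of the run does not overwrite the value just
      written.\<close>
    have "Some \<sigma> \<notin> Some ` set ss"
      using Cons.prems(1) by auto
    then show ?thesis
      using 0 by (auto intro!: exI[of _ x] simp: process_unchanged)
  next
    case (Suc m)
    then show ?thesis
      using Cons.IH Cons.prems by simp
  qed
qed simp

lemma snd_process_le:
  assumes "\<And>x \<sigma>. \<sigma> \<in> set ss \<Longrightarrow> snd (seq_value G i anc l q x \<sigma>) \<le> B"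
  shows "snd (process G i anc l q ss x) \<le> length ss * B"
  using assms
proof (induction ss arbitrary: x)
  case (Cons \<sigma> ss)
  then show ?case
    by (simp add: add_mono)
qed (simp add: op_defs)

section \<open>Consequences of the top-down order\<close>

context perfect_recall_player
begin

lemma top_down_order_nth:
  assumes "top_down_order G i ss" "k < length ss"
  shows "fst (ss ! k) \<in> infosets G i"
  using assms nth_mem[of k ss] by (auto simp: top_down_order_def seqs_nonempty_def)

text \<open>The order directly guarantees only the parent of the current information set. The other
  ancestors are those of the parent's information set, which occurs at an earlier position
  \<open>m\<close>, so induction on the position applies.\<close>

lemma top_down_order_ancestor:
  assumes ss: "top_down_order G i ss" and "k < length ss" "j \<in> ancestors (fst (ss ! k))"
  shows "parent_seq G i j \<in> insert None (Some ` set (take k ss))"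
  using assms(2,3)
proof (induction k rule: less_induct)
  case (less k)
  let ?j = "fst (ss ! k)"
  have p: "parent_seq G i ?j \<in> insert None (Some ` set (take k ss))"
    using ss less.prems(1) by (simp add: top_down_order_def)
  note j = top_down_order_nth[OF ss less.prems(1)]
  show ?case
  proof (cases "parent_seq G i ?j")
    case None
    then show ?thesis
      using ancestors_root[OF j None] less.prems(2) by (metis insertI1 singletonD)
  next
    case (Some ka)
    then have "ka \<in> set (take k ss)"
      using p by auto
    then obtain m where m: "m < k" "ka = ss ! m"
      using less.prems(1) by (auto simp: in_set_conv_nth)
    have "parent_seq G i ?j = Some (fst (ss ! m), snd (ss ! m))"
      using Some m(2) by simp
    then have "j = ?j \<or> j \<in> ancestors (fst (ss ! m))"
      using ancestors_parent(1)[OF j] less.prems(2) by blast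
    then show ?thesis
    proof
      assume "j \<in> ancestors (fst (ss ! m))"
      then have "parent_seq G i j \<in> insert None (Some ` set (take m ss))"
        using less.IH[OF m(1)] less.prems(1) m(1) by simp
      moreover have "set (take m ss) \<subseteq> set (take k ss)"
        using m(1) by (intro set_take_subset_set_take) simp
      ultimately show ?thesis
        by blast
    qed (use p in simp)
  qed
qed

text \<open>All entries read at position \<open>k\<close> were written earlier or belong to the
  empty sequence, so they are final and the assignment becomes an equation for the output.\<close>

lemma fixpoint_algorithm_step:
  assumes anc: "enumerates_ancestors G i anc" and ss: "top_down_order G i ss"
    and x: "x = fst (fixpoint_algorithm G i anc ss l q)"
    and k: "k < length ss"
  shows "x (Some (ss ! k)) =
    (let j = fst (ss ! k); d = \<Sum>j'\<in>ancestors j. l j'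
     in if d = 0 then x (parent_seq G i j) / real (card (actions_at G j))
        else 1 / d * (\<Sum>j'\<in>ancestors j. l j' * q j' (Some (ss ! k)) * x (parent_seq G i j')))"
proof -
  let ?j = "fst (ss ! k)"
  have dist: "distinct ss"
    using ss by (simp add: top_down_order_def)
  have run: "x = fst (process G i anc l q ss ((\<lambda>\<sigma>. 0)(None := 1)))"
    using x by (simp add: fixpoint_algorithm_def)
  obtain z where z: "x (Some (ss ! k)) = fst (seq_value G i anc l q z (ss ! k))"
    "\<And>\<tau>. \<tau> \<notin> Some ` set (drop k ss) \<Longrightarrow> z \<tau> = x \<tau>"
    using process_value[OF dist k, of G i anc l q "(\<lambda>\<sigma>. 0)(None := 1)", folded run] by blast
  have j: "?j \<in> infosets G i"
    using top_down_order_nth[OF ss k] .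
  then have anc_j: "distinct (anc ?j)" "set (anc ?j) = ancestors ?j"
    using anc by (auto simp: enumerates_ancestors_def ancestors_def)
  have "set (take k ss) \<inter> set (drop k ss) = {}"
    using dist by (rule set_take_disj_set_drop_if_distinct) simp
  then have agree: "z (parent_seq G i j') = x (parent_seq G i j')" if "j' \<in> ancestors ?j" for j'
    using top_down_order_ancestor[OF ss k that] by (intro z(2)) auto
  \<comment> \<open>Needed for the uniform branch, which reads the parent entry of \<open>?j\<close>
    itself.\<close>
  have "?j \<in> ancestors ?j"
    using ancestors_eq[OF j] by simp
  then show ?thesis
    unfolding z(1) fst_seq_value[of anc "ss ! k", OF anc_j(1)] anc_j(2)
    using agree by (simp add: Let_def)
qed

text \<open>Induction along the processing order: each value combines nonnegative weights with
  entries at earlier positions or at the empty sequence.\<close>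

lemma fixpoint_algorithm_nonneg:
  assumes anc: "enumerates_ancestors G i anc" and ss: "top_down_order G i ss"
    and x: "x = fst (fixpoint_algorithm G i anc ss l q)"
    and l: "\<And>j. j \<in> infosets G i \<Longrightarrow> 0 \<le> l j"
    and q: "\<And>j \<sigma>. j \<in> infosets G i \<Longrightarrow> 0 \<le> q j \<sigma>"
    and x_None: "x None = 1"
    and k: "k < length ss"
  shows "0 \<le> x (Some (ss ! k))"
  using k
proof (induction k rule: less_induct)
  case (less k)
  let ?j = "fst (ss ! k)"
  have parent: "0 \<le> x (parent_seq G i j)" if "j \<in> ancestors ?j" for j
  proof (cases "parent_seq G i j")
    case None
    then show ?thesis
      using x_None by simp
  next
    case (Some ja)
    then have "ja \<in> set (take k ss)"
      using top_down_order_ancestor[OF ss less.prems that] by auto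
    then obtain m where "m < k" "ja = ss ! m"
      using less.prems by (auto simp: in_set_conv_nth)
    then show ?thesis
      using less Some by simp
  qed
  have "?j \<in> ancestors ?j"
    using top_down_order_nth[OF ss less.prems] ancestors_eq by simp
  then show ?case
    unfolding fixpoint_algorithm_step[OF anc ss x less.prems] Let_def
    using parent l q ancestors_subset[of ?j]
    by (auto intro!: divide_nonneg_nonneg mult_nonneg_nonneg sum_nonneg)
qed

theorem fixpoint_algorithm_correct:
  assumes anc: "enumerates_ancestors G i anc" and ss: "top_down_order G i ss"
    and l: "l \<in> distributions (infosets G i)"
    and q: "\<And>j. j \<in> infosets G i \<Longrightarrow> q j \<in> strategies_below G i j"
    and x: "x = fst (fixpoint_algorithm G i anc ss l q)"
  shows "x \<in> strategies G i"
    and "(\<Sum>j\<in>infosets G i. l j * trigger G i j (q j) x \<sigma>) = x \<sigma>"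
proof -
  have set_ss: "set ss = seqs_nonempty G i"
    using ss by (simp add: top_down_order_def)
  \<comment> \<open>Entries never assigned keep their initial value: 1 at the empty sequence and 0
    off the index set.\<close>
  have unset: "x \<tau> = ((\<lambda>\<sigma>. 0)(None := 1)) \<tau>" if "\<tau> \<notin> Some ` seqs_nonempty G i" for \<tau>
    using that set_ss unfolding x fixpoint_algorithm_def by (intro process_unchanged) simp
  have x_None: "x None = 1"
    using unset[of None] by auto
  have index: "\<exists>k<length ss. ss ! k = (j, a)" if "Some (j, a) \<in> seqs G i" for j a
    using that set_ss in_set_conv_nth[of "(j, a)" ss] by (auto simp: seqs_def)
  have step: "x (Some (j, a)) =
      (let d = \<Sum>j'\<in>ancestors j. l j'
       in if d = 0 then x (parent_seq G i j) / real (card (actions_at G j))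
          else 1 / d * (\<Sum>j'\<in>ancestors j. l j' * q j' (Some (j, a)) * x (parent_seq G i j')))"
    if ja: "Some (j, a) \<in> seqs G i" for j a
  proof -
    obtain k where "k < length ss" "ss ! k = (j, a)"
      using index[OF ja] by blast
    then show ?thesis
      using fixpoint_algorithm_step[OF anc ss x, of k] by simp
  qed
  \<comment> \<open>Resolving the equation for \<open>d\<close> with \<open>refl\<close> fixes it as
    the sum of \<open>l\<close> over the ancestors.\<close>
  note main = flow_and_fixpoint[OF l q refl step[unfolded Let_def]]
  show "(\<Sum>j\<in>infosets G i. l j * trigger G i j (q j) x \<sigma>) = x \<sigma>"
    using main(2) .
  have q_nonneg: "0 \<le> q j \<tau>" if "j \<in> infosets G i" for j \<tau>
    using q[OF that] by (cases "\<tau> \<in> seqs_below G i j") (auto simp: strategies_below_def nonneg_vecs_def)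
  have "0 \<le> x \<tau>" if \<tau>: "\<tau> \<in> seqs G i" for \<tau>
  proof (cases \<tau>)
    case None
    then show ?thesis
      using x_None by simp
  next
    case (Some ja)
    then obtain k where "k < length ss" "ss ! k = ja"
      using index \<tau> by (metis surj_pair)
    moreover have "\<And>j. j \<in> infosets G i \<Longrightarrow> 0 \<le> l j"
      using l by (simp add: distributions_def)
    ultimately show ?thesis
      using fixpoint_algorithm_nonneg[OF anc ss x _ q_nonneg x_None] Some by blast
  qed
  moreover have "x \<tau> = 0" if "\<tau> \<notin> seqs G i" for \<tau>
    using that unset by (auto simp: seqs_def)
  ultimately show "x \<in> strategies G i"
    using main(1) x_None by (simp add: strategies_def nonneg_vecs_def)
qed

section \<open>Operation count\<close>

theorem fixpoint_algorithm_time: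
  assumes anc: "enumerates_ancestors G i anc" and ss: "top_down_order G i ss"
  shows "snd (fixpoint_algorithm G i anc ss l q) \<le> 7 * (card (seqs G i) * max_depth G i)"
proof -
  have cost: "snd (seq_value G i anc l q x \<sigma>) \<le> 7 * max_depth G i" if "\<sigma> \<in> set ss" for x \<sigma>
  proof -
    have j: "fst \<sigma> \<in> infosets G i"
      using that ss by (auto simp: top_down_order_def seqs_nonempty_def)
    then have "length (anc (fst \<sigma>)) = card (ancestors (fst \<sigma>))"
      using anc distinct_card by (fastforce simp: enumerates_ancestors_def ancestors_def)
    \<comment> \<open>With \<open>n\<close> ancestors, \<open>4 * n + 3\<close> is at most
      \<open>7 * n\<close> because \<open>n\<close> is positive, and \<open>n\<close> is at most the
      depth.\<close>
    then show ?thesis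
      using card_ancestors_pos[OF j] card_ancestors_le_max_depth[OF j]
        snd_seq_value_le[of G i anc l q x \<sigma>] by linarith
  qed
  have "length ss = card (seqs_nonempty G i)"
    using ss distinct_card by (fastforce simp: top_down_order_def)
  also have "\<dots> = card (Some ` seqs_nonempty G i)"
    by (simp add: card_image)
  also have "\<dots> \<le> card (seqs G i)"
    using finite_seqs by (intro card_mono) (auto simp: seqs_def)
  finally have "length ss * (7 * max_depth G i) \<le> card (seqs G i) * (7 * max_depth G i)"
    by simp
  then show ?thesis
    using snd_process_le[OF cost, of ss] unfolding fixpoint_algorithm_def
    by (metis (no_types, lifting) le_trans mult.left_commute)
qed

end

text \<open>Used at two levels: to evaluate a sum of maps at a vector, and the resulting sum of
  vectors at a sequence.\<close>

lemma sum_fun_apply: "(\<Sum>j\<in>A. f j) x = (\<Sum>j\<in>A. f j x)"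
  by (induction A rule: infinite_finite_induct) simp_all

theorem theorem5p1:
  shows "\<exists>C::nat. \<forall>(G :: ('a, 'p) efg) i l q \<phi> anc ss qi t.
    extensive_form_game G \<and> perfect_recall G \<and> i \<in> players G \<and>
    l \<in> distributions (infosets G i) \<and>
    (\<forall>j\<in>infosets G i. q j \<in> strategies_below G i j) \<and>
    \<phi> = (\<Sum>j\<in>infosets G i. l j *\<^sub>R trigger G i j (q j)) \<and>
    \<phi> \<in> convex hull (coarse_triggers G i) \<and>
    enumerates_ancestors G i anc \<and> top_down_order G i ss \<and>
    fixpoint_algorithm G i anc ss l q = (qi, t)
    \<longrightarrow> qi \<in> strategies G i \<and> \<phi> qi = qi \<and> t \<le> C * (card (seqs G i) * max_depth G i)"
\<comment> \<open>The constant is the one from the operation count and is fixed before the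
  game.\<close>
proof (intro exI[of _ 7] allI impI, elim conjE)
  fix G :: "('a, 'p) efg" and i l q \<phi> anc ss qi t
  assume "extensive_form_game G" "perfect_recall G" "i \<in> players G"
  then interpret perfect_recall_player G i
    by unfold_locales
  assume l: "l \<in> distributions (infosets G i)"
    and q: "\<forall>j\<in>infosets G i. q j \<in> strategies_below G i j"
    and \<phi>: "\<phi> = (\<Sum>j\<in>infosets G i. l j *\<^sub>R trigger G i j (q j))"
    and anc: "enumerates_ancestors G i anc" and ss: "top_down_order G i ss"
    and run: "fixpoint_algorithm G i anc ss l q = (qi, t)"
  have qi: "qi = fst (fixpoint_algorithm G i anc ss l q)"
    using run by simp
  note correct = fixpoint_algorithm_correct[OF anc ss l bspec[OF q] qi]
  have "\<phi> qi = qi"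
    using correct(2) by (simp add: \<phi> fun_eq_iff sum_fun_apply scaleR_fun_def)
  then show "qi \<in> strategies G i \<and> \<phi> qi = qi \<and> t \<le> 7 * (card (seqs G i) * max_depth G i)"
    using correct(1) fixpoint_algorithm_time[OF anc ss, of l q] run by simp
qed

end
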